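(* Let $\mathcal{A}$ be an independence algebra with universe $A$ and let $\mathcal{B}$ be a non-empty subalgebra of $\mathcal{A}$ with universe $B$. Assume $\mathcal{B}\neq\mathcal{A}$ and that either $\dim B\geq 2$, or $\langle\emptyset\rangle\neq\emptyset$ and $\dim B=1$. Let $T(\mathcal{A},\mathcal{B})$ be the semigroup of all endomorphisms of $\mathcal{A}$ whose image is contained in $B$. Then $T(\mathcal{A},\mathcal{B})$ is right abundant (and thus right Fountain), but it is neither left abundant nor left Fountain.
   Context: An algebra $\mathcal{A}=\langle A;F\rangle$ has a non-empty universe $A$ and a set $F$ of finitary operations. For $X\subseteq A$, $\langle X\rangle$ is the set of all $t(a_1,\dots,a_n)$ with $t$ a term operation and $a_i\in X$ (the subalgebra generated by $X$); $\langle\emptyset\rangle$ is the set of constants, i.e. values of nullary term operations (possibly empty). $X$ is independent if $x\notin\langle X\setminus\{x\}\rangle$ for all $x\in X$; a basis of a subalgebra is an independent generating set. Exchange property (EP): for all $X\subseteq A$ and $a,b\in A$, if $b\in\langle X\cup\{a\}\rangle$ and $b\notin\langle X\rangle$ then $a\in\langle X\cup\{b\}\rangle$. Under (EP) every subalgebra has a basis, all its bases have the same cardinality (its dimension, $\dim$), and independent sets extend to bases. Free basis property (F): every map from a basis of $\mathcal{A}$ to $A$ extends to an endomorphism of $\mathcal{A}$. An independence algebra is an algebra satisfying (EP) and (F). Dimensions may be finite or infinite. Maps are written on the right and composed left to right. For a semigroup $S$ with set of idempotents $E(S)$ and $a,b\in S$ ($S^1$ denotes $S$ with an identity adjoined if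 necessary): $a\,\mathcal{L}^*\,b$ iff for all $x,y\in S^1$, $ax=ay\Leftrightarrow bx=by$; $a\,\mathcal{R}^*\,b$ iff for all $x,y\in S^1$, $xa=ya\Leftrightarrow xb=yb$; $a\,\widetilde{\mathcal{L}}\,b$ iff for all $f\in E(S)$, $af=a\Leftrightarrow bf=b$; $a\,\widetilde{\mathcal{R}}\,b$ iff for all $f\in E(S)$, $fa=a\Leftrightarrow fb=b$. $S$ is left abundant [left Fountain] if every $\mathcal{R}^*$-class [every $\widetilde{\mathcal{R}}$-class] contains an idempotent, and right abundant [right Fountain] if every $\mathcal{L}^*$-class [every $\widetilde{\mathcal{L}}$-class] contains an idempotent. *)

theory Defs
  imports Main "HOL-Library.FuncSet"
begin

unbundle cardinal_syntax

text \<open>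
  An operation is a pair of an arity n and a function on argument lists; only the values on
  lists of length n over the universe are ever used. Constants are the operations of arity 0.
\<close>

type_synonym 'a operation = "nat \<times> ('a list \<Rightarrow> 'a)"

definition closed_under :: "'a operation set \<Rightarrow> 'a set \<Rightarrow> bool" where
  "closed_under F B \<longleftrightarrow>
     (\<forall>(n, f)\<in>F. \<forall>xs. length xs = n \<and> set xs \<subseteq> B \<longrightarrow> f xs \<in> B)"

locale universal_algebra =
  fixes A :: "'a set" and F :: "'a operation set"
  assumes nonempty: "A \<noteq> {}"
    and closed: "closed_under F A"

definition is_subalgebra :: "'a set \<Rightarrow> 'a operation set \<Rightarrow> 'a set \<Rightarrow> bool" where
  "is_subalgebra A F B \<longleftrightarrow> B \<subseteq> A \<and> closed_under F B"

inductive term_operation :: "'a operation set \<Rightarrow> nat \<Rightarrow> ('a list \<Rightarrow> 'a) \<Rightarrow> bool"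
  for F :: "'a operation set" and n :: nat where
  projection: "i < n \<Longrightarrow> term_operation F n (\<lambda>xs. xs ! i)"
| composition: "(k, f) \<in> F \<Longrightarrow> length ts = k \<Longrightarrow> (\<forall>t\<in>set ts. term_operation F n t) \<Longrightarrow>
    term_operation F n (\<lambda>xs. f (map (\<lambda>t. t xs) ts))"

text \<open>For empty X only n = 0 contributes, so this is then the set of values of nullary terms.\<close>

definition generated :: "'a operation set \<Rightarrow> 'a set \<Rightarrow> 'a set" where
  "generated F X = {t xs | n t xs. term_operation F n t \<and> length xs = n \<and> set xs \<subseteq> X}"

definition independent_set :: "'a operation set \<Rightarrow> 'a set \<Rightarrow> bool" where
  "independent_set F X \<longleftrightarrow> (\<forall>x\<in>X. x \<notin> generated F (X - {x}))"

definition is_basis :: "'a operation set \<Rightarrow> 'a set \<Rightarrow> 'a set \<Rightarrow> bool" where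
  "is_basis F B X \<longleftrightarrow> independent_set F X \<and> generated F X = B"

text \<open>
  The dimension is a cardinal, in the library's sense of a cardinal order. It is meaningful
  under the exchange property, where bases exist and all have the same cardinality.
\<close>

definition dimension :: "'a operation set \<Rightarrow> 'a set \<Rightarrow> 'a rel" where
  "dimension F B = |SOME X. is_basis F B X|"

definition endomorphisms :: "'a set \<Rightarrow> 'a operation set \<Rightarrow> ('a \<Rightarrow> 'a) set" where
  "endomorphisms A F = {h \<in> A \<rightarrow>\<^sub>E A.
     \<forall>(n, f)\<in>F. \<forall>xs. length xs = n \<and> set xs \<subseteq> A \<longrightarrow> h (f xs) = f (map h xs)}"

locale independence_algebra = universal_algebra A F
  for A :: "'a set" and F :: "'a operation set" +
  assumes exchange: "\<And>X a b. X \<subseteq> A \<Longrightarrow> a \<in> A \<Longrightarrow> b \<in> A \<Longrightarrow>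
      b \<in> generated F (X \<union> {a}) \<Longrightarrow> b \<notin> generated F X \<Longrightarrow> a \<in> generated F (X \<union> {b})"
    and free_basis: "\<And>X g. is_basis F A X \<Longrightarrow> X \<subseteq> A \<Longrightarrow> g \<in> X \<rightarrow> A \<Longrightarrow>
      \<exists>h\<in>endomorphisms A F. \<forall>x\<in>X. h x = g x"

text \<open>
  A semigroup is a carrier S with a product m. For S with an identity adjoined if necessary,
  elements are of type option, with None as the adjoined identity.
\<close>

definition has_identity :: "'s set \<Rightarrow> ('s \<Rightarrow> 's \<Rightarrow> 's) \<Rightarrow> bool" where
  "has_identity S m \<longleftrightarrow> (\<exists>e\<in>S. \<forall>x\<in>S. m e x = x \<and> m x e = x)"

definition carrier1 :: "'s set \<Rightarrow> ('s \<Rightarrow> 's \<Rightarrow> 's) \<Rightarrow> 's option set" where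
  "carrier1 S m = Some ` S \<union> (if has_identity S m then {} else {None})"

fun mult1 :: "('s \<Rightarrow> 's \<Rightarrow> 's) \<Rightarrow> 's option \<Rightarrow> 's option \<Rightarrow> 's option" where
  "mult1 m None y = y"
| "mult1 m x None = x"
| "mult1 m (Some x) (Some y) = Some (m x y)"

definition idempotents :: "'s set \<Rightarrow> ('s \<Rightarrow> 's \<Rightarrow> 's) \<Rightarrow> 's set" where
  "idempotents S m = {e\<in>S. m e e = e}"

definition L_star :: "'s set \<Rightarrow> ('s \<Rightarrow> 's \<Rightarrow> 's) \<Rightarrow> 's rel" where
  "L_star S m = {(a, b). a \<in> S \<and> b \<in> S \<and> (\<forall>x\<in>carrier1 S m. \<forall>y\<in>carrier1 S m.
     mult1 m (Some a) x = mult1 m (Some a) y \<longleftrightarrow> mult1 m (Some b) x = mult1 m (Some b) y)}"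

definition R_star :: "'s set \<Rightarrow> ('s \<Rightarrow> 's \<Rightarrow> 's) \<Rightarrow> 's rel" where
  "R_star S m = {(a, b). a \<in> S \<and> b \<in> S \<and> (\<forall>x\<in>carrier1 S m. \<forall>y\<in>carrier1 S m.
     mult1 m x (Some a) = mult1 m y (Some a) \<longleftrightarrow> mult1 m x (Some b) = mult1 m y (Some b))}"

definition L_tilde :: "'s set \<Rightarrow> ('s \<Rightarrow> 's \<Rightarrow> 's) \<Rightarrow> 's rel" where
  "L_tilde S m = {(a, b). a \<in> S \<and> b \<in> S \<and>
     (\<forall>f\<in>idempotents S m. m a f = a \<longleftrightarrow> m b f = b)}"

definition R_tilde :: "'s set \<Rightarrow> ('s \<Rightarrow> 's \<Rightarrow> 's) \<Rightarrow> 's rel" where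
  "R_tilde S m = {(a, b). a \<in> S \<and> b \<in> S \<and>
     (\<forall>f\<in>idempotents S m. m f a = a \<longleftrightarrow> m f b = b)}"

definition left_abundant :: "'s set \<Rightarrow> ('s \<Rightarrow> 's \<Rightarrow> 's) \<Rightarrow> bool" where
  "left_abundant S m \<longleftrightarrow> (\<forall>K\<in>S // R_star S m. K \<inter> idempotents S m \<noteq> {})"

definition right_abundant :: "'s set \<Rightarrow> ('s \<Rightarrow> 's \<Rightarrow> 's) \<Rightarrow> bool" where
  "right_abundant S m \<longleftrightarrow> (\<forall>K\<in>S // L_star S m. K \<inter> idempotents S m \<noteq> {})"

definition left_Fountain :: "'s set \<Rightarrow> ('s \<Rightarrow> 's \<Rightarrow> 's) \<Rightarrow> bool" where
  "left_Fountain S m \<longleftrightarrow> (\<forall>K\<in>S // R_tilde S m. K \<inter> idempotents S m \<noteq> {})"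

definition right_Fountain :: "'s set \<Rightarrow> ('s \<Rightarrow> 's \<Rightarrow> 's) \<Rightarrow> bool" where
  "right_Fountain S m \<longleftrightarrow> (\<forall>K\<in>S // L_tilde S m. K \<inter> idempotents S m \<noteq> {})"

definition T_semigroup :: "'a set \<Rightarrow> 'a operation set \<Rightarrow> 'a set \<Rightarrow> ('a \<Rightarrow> 'a) set" where
  "T_semigroup A F B = {h \<in> endomorphisms A F. h ` A \<subseteq> B}"

text \<open>Maps act on the right: in the product of a and b, the map a is applied first.\<close>

definition right_comp :: "'a set \<Rightarrow> ('a \<Rightarrow> 'a) \<Rightarrow> ('a \<Rightarrow> 'a) \<Rightarrow> ('a \<Rightarrow> 'a)" where
  "right_comp A a b = compose A b a"

lemma T_semigroup_closed:
  assumes "universal_algebra A F" "is_subalgebra A F B"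
    and a: "a \<in> T_semigroup A F B" and b: "b \<in> T_semigroup A F B"
  shows "right_comp A a b \<in> T_semigroup A F B"
proof -
  have clA: "\<And>n f xs. (n, f) \<in> F \<Longrightarrow> length xs = n \<Longrightarrow> set xs \<subseteq> A \<Longrightarrow> f xs \<in> A"
  proof -
    fix n f xs assume f: "(n, f) \<in> F" and xs: "length xs = n" "set xs \<subseteq> A"
    have "\<forall>(n, f)\<in>F. \<forall>xs. length xs = n \<and> set xs \<subseteq> A \<longrightarrow> f xs \<in> A"
      using universal_algebra.closed[OF assms(1)] unfolding closed_under_def .
    from bspec[OF this f] xs show "f xs \<in> A" by simp
  qed
  have aA: "a \<in> A \<rightarrow> A" and bA: "b \<in> A \<rightarrow> A" and bB: "b ` A \<subseteq> B"
    using a b by (simp_all add: T_semigroup_def endomorphisms_def PiE_def)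
  have hom: "h (f xs) = f (map h xs)"
    if "h \<in> T_semigroup A F B" "(n, f) \<in> F" "length xs = n" "set xs \<subseteq> A" for h n f xs
  proof -
    have "\<forall>(n, f)\<in>F. \<forall>xs. length xs = n \<and> set xs \<subseteq> A \<longrightarrow> h (f xs) = f (map h xs)"
      using that(1) by (simp add: T_semigroup_def endomorphisms_def)
    from bspec[OF this that(2)] that(3,4) show ?thesis by simp
  qed
  have "right_comp A a b (f xs) = f (map (right_comp A a b) xs)"
    if "(n, f) \<in> F" "length xs = n" "set xs \<subseteq> A" for n f xs
  proof -
    have "set (map a xs) \<subseteq> A" using that aA by auto
    then have "b (f (map a xs)) = f (map b (map a xs))" using hom[OF b that(1)] that(2) by simp
    moreover have "map (right_comp A a b) xs = map b (map a xs)"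
      using that by (auto simp: right_comp_def compose_def)
    moreover have "right_comp A a b (f xs) = b (f (map a xs))"
      using clA[OF that] hom[OF a that] by (simp add: right_comp_def compose_def)
    ultimately show ?thesis by (simp del: map_map)
  qed
  moreover have "right_comp A a b \<in> A \<rightarrow>\<^sub>E A" "right_comp A a b ` A \<subseteq> B"
    using aA bA bB by (auto simp: right_comp_def compose_def)
  ultimately show ?thesis
    unfolding T_semigroup_def endomorphisms_def by blast
qed

lemma right_comp_assoc:
  assumes "a \<in> T_semigroup A F B"
  shows "right_comp A (right_comp A a b) c = right_comp A a (right_comp A b c)"
proof
  have "a \<in> A \<rightarrow> A" using assms by (simp add: T_semigroup_def endomorphisms_def PiE_def)
  then show "right_comp A (right_comp A a b) c x = right_comp A a (right_comp A b c) x" for x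
    by (cases "x \<in> A") (simp_all add: right_comp_def compose_def Pi_iff)
qed

end

theory Submission
  imports Defs
begin

text \<open>
  The products \<open>a x\<close> and \<open>a y\<close> coincide iff \<open>x\<close> and \<open>y\<close> agree on the image of \<open>a\<close>, so maps with
  equal images are \<open>\<L>\<^sup>*\<close>-related; extending a basis of the image of \<open>a\<close> to a basis of the whole
  algebra yields an idempotent with that image. On the other side, an idempotent \<open>e\<close> that is
  \<open>\<R>\<close>-tilde-related to \<open>a\<close> satisfies \<open>e a = a\<close>, so that \<open>a\<close> maps \<open>A\<close> into \<open>a ` B\<close>. The dimension
  hypothesis provides \<open>u, v\<close> in \<open>B\<close> with \<open>v\<close> outside the subalgebra generated by \<open>u\<close>; the
  endomorphism sending a basis of \<open>B\<close> to \<open>u\<close> and the remaining elements of a basis of the algebra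
  to \<open>v\<close> violates this.
\<close>

section \<open>Generated subalgebras\<close>

lemma closed_underD:
  "closed_under F B \<Longrightarrow> (n, f) \<in> F \<Longrightarrow> length xs = n \<Longrightarrow> set xs \<subseteq> B \<Longrightarrow> f xs \<in> B"
  unfolding closed_under_def by (drule (1) bspec) simp

text \<open>Renaming variables turns projection \<open>i\<close> into projection \<open>s i\<close>
  and passes through compositions.\<close>

lemma term_operation_reindex:
  assumes "term_operation F n t" "\<And>i. i < n \<Longrightarrow> s i < m"
  shows "term_operation F m (\<lambda>zs. t (map (\<lambda>i. zs ! s i) [0..<n]))"
  using assms(1)
proof induction
  case (projection i)
  then have "(\<lambda>zs :: 'a list. map (\<lambda>i. zs ! s i) [0..<n] ! i) = (\<lambda>zs. zs ! s i)"
    by auto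
  then show ?case
    using term_operation.projection[OF assms(2)[OF projection]] by (simp only:)
next
  case (composition k f ts)
  let ?g = "\<lambda>zs. map (\<lambda>i. zs ! s i) [0..<n]"
  have "term_operation F m (\<lambda>zs. f (map (\<lambda>t. t zs) (map (\<lambda>t zs. t (?g zs)) ts)))"
    using composition by (intro term_operation.composition[where k = k]) auto
  then show ?case by (simp add: comp_def)
qed

text \<open>Shifting indices by \<open>length ys\<close> adds dummy variables on both sides. This
  lets terms with different argument lists be read on one common list.\<close>

lemma term_operation_append:
  assumes "term_operation F (length xs) t"
  shows "\<exists>t'. term_operation F (length (ys @ xs @ zs)) t' \<and> t' (ys @ xs @ zs) = t xs"
proof (intro exI conjI)
  let ?t = "\<lambda>ws. t (map (\<lambda>i. ws ! (length ys + i)) [0..<length xs])"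
  show "term_operation F (length (ys @ xs @ zs)) ?t"
    by (rule term_operation_reindex[OF assms]) simp
  have "map (\<lambda>i. (ys @ xs @ zs) ! (length ys + i)) [0..<length xs] = xs"
    by (rule nth_equalityI) (auto simp: nth_append)
  then show "?t (ys @ xs @ zs) = t xs" by simp
qed

lemma generatedI:
  "term_operation F (length xs) t \<Longrightarrow> set xs \<subseteq> X \<Longrightarrow> t xs \<in> generated F X"
  unfolding generated_def by blast

lemma generatedE:
  assumes "y \<in> generated F X"
  obtains t xs where "term_operation F (length xs) t" "set xs \<subseteq> X" "y = t xs"
  using assms unfolding generated_def by blast

lemma subset_generated: "X \<subseteq> generated F X"
proof
  fix x assume "x \<in> X"
  then show "x \<in> generated F X"
    using generatedI[of F "[x]" "\<lambda>xs. xs ! 0" X] term_operation.projection[of 0 1 F] by simp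
qed

lemma generated_mono: "X \<subseteq> Y \<Longrightarrow> generated F X \<subseteq> generated F Y"
  unfolding generated_def by blast

text \<open>A term has finitely many arguments. This finitary character is what makes Zorn's lemma
  applicable to independent sets.\<close>

lemma generated_finite:
  assumes "y \<in> generated F X"
  obtains Y where "finite Y" "Y \<subseteq> X" "y \<in> generated F Y"
  using assms generatedE generatedI by (metis List.finite_set order_refl)

text \<open>\<open>composition\<close> demands subterms of one common arity, whereas each element of
  \<open>ys\<close> comes with its own term and arguments. Concatenating the argument lists one
  element at a time removes the mismatch.\<close>

lemma generated_common_arguments:
  assumes "set ys \<subseteq> generated F X"
  shows "\<exists>ts xs. set xs \<subseteq> X \<and> (\<forall>t\<in>set ts. term_operation F (length xs) t)
    \<and> map (\<lambda>t. t xs) ts = ys"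
  using assms
proof (induction ys)
  case Nil
  show ?case by (rule exI[of _ "[]"], rule exI[of _ "[]"]) simp
next
  case (Cons y ys)
  then obtain ts xs where IH: "set xs \<subseteq> X" "\<forall>t\<in>set ts. term_operation F (length xs) t"
    "map (\<lambda>t. t xs) ts = ys" by auto
  from Cons.prems have "y \<in> generated F X" by simp
  then obtain t zs where y: "term_operation F (length zs) t" "set zs \<subseteq> X" "y = t zs"
    by (rule generatedE)
  obtain t' where t': "term_operation F (length (zs @ xs)) t'" "t' (zs @ xs) = y"
    using term_operation_append[OF y(1), of "[]" xs] y(3) by auto
  \<comment> \<open>The terms already found are padded so that they ignore the new prefix
    \<open>zs\<close>.\<close>
  have "\<forall>r\<in>set ts. \<exists>r'. term_operation F (length (zs @ xs)) r' \<and> r' (zs @ xs) = r xs"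
    using IH(2) term_operation_append[of F xs _ zs "[]"] by simp
  then obtain \<phi> where \<phi>: "\<forall>r\<in>set ts. term_operation F (length (zs @ xs)) (\<phi> r)
      \<and> \<phi> r (zs @ xs) = r xs" by metis
  have "map (\<lambda>t. t (zs @ xs)) (t' # map \<phi> ts) = y # ys"
    using \<phi> t' IH(3) by auto
  moreover have "\<forall>r\<in>set (t' # map \<phi> ts). term_operation F (length (zs @ xs)) r"
    using \<phi> t' by auto
  ultimately show ?case using IH(1) y(2)
    by (intro exI[of _ "t' # map \<phi> ts"] exI[of _ "zs @ xs"]) auto
qed

lemma closed_under_generated: "closed_under F (generated F X)"
  unfolding closed_under_def
proof (clarify)
  fix f xs assume f: "(length xs, f) \<in> F" and "set xs \<subseteq> generated F X"
  then obtain ts zs where "set zs \<subseteq> X" "\<forall>t\<in>set ts. term_operation F (length zs) t"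
    and xs: "map (\<lambda>t. t zs) ts = xs"
    using generated_common_arguments by metis
  moreover from xs have "length ts = length xs" by auto
  ultimately show "f xs \<in> generated F X"
    using generatedI[OF term_operation.composition[OF f]] by blast
qed

lemma term_operation_closed:
  assumes "term_operation F n t" "closed_under F B" "length xs = n" "set xs \<subseteq> B"
  shows "t xs \<in> B"
  using assms(1)
proof induction
  case (projection i)
  then show ?case using assms(3,4) nth_mem by blast
next
  case (composition k f ts)
  then show ?case by (intro closed_underD[OF assms(2)]) auto
qed

lemma generated_least: "X \<subseteq> B \<Longrightarrow> closed_under F B \<Longrightarrow> generated F X \<subseteq> B"
  by (rule subsetI, erule generatedE) (metis term_operation_closed subset_trans)

section \<open>Endomorphisms\<close>

lemma endomorphism_apply:
  "h \<in> endomorphisms A F \<Longrightarrow> (n, f) \<in> F \<Longrightarrow> length xs = n \<Longrightarrow> set xs \<subseteq> A \<Longrightarrow>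
    h (f xs) = f (map h xs)"
  unfolding endomorphisms_def by (drule CollectD, drule conjunct2, drule (1) bspec) simp

lemma endomorphism_extensional: "h \<in> endomorphisms A F \<Longrightarrow> h \<in> extensional A"
  unfolding endomorphisms_def by (simp add: PiE_def)

lemma endomorphism_image_closed:
  assumes h: "h \<in> endomorphisms A F" and C: "C \<subseteq> A" "closed_under F C"
  shows "closed_under F (h ` C)"
  unfolding closed_under_def
proof (clarify)
  fix f xs assume f: "(length xs, f) \<in> F" and "set xs \<subseteq> h ` C"
  \<comment> \<open>Preimages in \<open>C\<close> are chosen entry by entry, giving a list
    \<open>ys\<close> to which the homomorphism law applies.\<close>
  then have "xs \<in> lists (h ` C)" by auto
  then obtain ys where ys: "set ys \<subseteq> C" "xs = map h ys"
    unfolding lists_image by auto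
  then have "f xs = h (f ys)" "f ys \<in> C"
    using endomorphism_apply[OF h f, of ys] closed_underD[OF C(2) f, of ys] C(1) by auto
  then show "f xs \<in> h ` C" by simp
qed

lemma endomorphism_preimage_closed:
  assumes h: "h \<in> endomorphisms A F" and A: "closed_under F A" and D: "closed_under F D"
  shows "closed_under F {x \<in> A. h x \<in> D}"
  unfolding closed_under_def
proof (clarify)
  fix f xs assume f: "(length xs, f) \<in> F" and "set xs \<subseteq> {x \<in> A. h x \<in> D}"
  then have xs: "set xs \<subseteq> A" "set (map h xs) \<subseteq> D" by auto
  show "f xs \<in> A \<and> h (f xs) \<in> D"
    using endomorphism_apply[OF h f _ xs(1)] closed_underD[OF A f _ xs(1)]
      closed_underD[OF D f _ xs(2)] by simp
qed

text \<open>The preimage of \<open>D\<close> is closed and contains \<open>X\<close>, hence contains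
  everything generated by \<open>X\<close>.\<close>

lemma endomorphism_generated_subset:
  assumes "h \<in> endomorphisms A F" "closed_under F A" "closed_under F D"
    and "X \<subseteq> A" "h ` X \<subseteq> D"
  shows "h ` generated F X \<subseteq> D"
  using generated_least[OF _ endomorphism_preimage_closed[OF assms(1-3)], of X] assms(4,5)
  by blast

text \<open>The fixed points of \<open>h\<close> in \<open>A\<close> are closed under the
  operations.\<close>

lemma endomorphism_fixes_generated:
  assumes h: "h \<in> endomorphisms A F" and A: "closed_under F A"
    and X: "X \<subseteq> A" "\<And>x. x \<in> X \<Longrightarrow> h x = x" and y: "y \<in> generated F X"
  shows "h y = y"
proof -
  have "closed_under F {x \<in> A. h x = x}"
    unfolding closed_under_def
  proof (clarify)
    fix f xs assume f: "(length xs, f) \<in> F" and "set xs \<subseteq> {x \<in> A. h x = x}"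
    then have xs: "set xs \<subseteq> A" "map h xs = xs" by (auto intro: map_idI)
    then show "f xs \<in> A \<and> h (f xs) = f xs"
      using endomorphism_apply[OF h f _ xs(1)] closed_underD[OF A f _ xs(1)] by simp
  qed
  from generated_least[OF _ this, of X] X y show ?thesis by blast
qed

section \<open>Bases in independence algebras\<close>

context independence_algebra
begin

text \<open>If an old element \<open>x\<close> became dependent, it would be generated by
  \<open>X - {x}\<close> together with \<open>a\<close> but not by \<open>X - {x}\<close> alone;
  exchange would then put \<open>a\<close> into \<open>generated F X\<close>.\<close>

lemma independent_insert:
  assumes X: "X \<subseteq> A" "independent_set F X" and a: "a \<in> A" "a \<notin> generated F X"
  shows "independent_set F (insert a X)"
  unfolding independent_set_def
proof
  fix x assume x: "x \<in> insert a X"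
  have aX: "a \<notin> X" using a(2) subsetD[OF subset_generated] by metis
  show "x \<notin> generated F (insert a X - {x})"
  proof (cases "x = a")
    case True
    then show ?thesis using a aX by simp
  next
    case False
    with x have xX: "x \<in> X" by simp
    have "insert a X - {x} = (X - {x}) \<union> {a}" "(X - {x}) \<union> {x} = X"
      using False xX by auto
    moreover have "x \<notin> generated F (X - {x})"
      using X xX unfolding independent_set_def by blast
    ultimately show ?thesis
      using exchange[of "X - {x}" a x] a X xX by auto
  qed
qed

text \<open>A dependence in the union involves finitely many elements, and these already lie in a
  single member of the chain.\<close>

lemma independent_Union_chain:
  assumes C: "\<C> \<noteq> {}" "subset.chain UNIV \<C>" and ind: "\<And>X. X \<in> \<C> \<Longrightarrow> independent_set F X"
  shows "independent_set F (\<Union>\<C>)"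
  unfolding independent_set_def
proof (intro ballI notI)
  fix x assume "x \<in> \<Union>\<C>" and x: "x \<in> generated F (\<Union>\<C> - {x})"
  from generated_finite[OF x] obtain Y where
    Y: "finite Y" "Y \<subseteq> \<Union>\<C> - {x}" "x \<in> generated F Y" .
  have "finite (insert x Y)" "insert x Y \<subseteq> \<Union>\<C>"
    using Y \<open>x \<in> \<Union>\<C>\<close> by auto
  then obtain X where X: "X \<in> \<C>" "insert x Y \<subseteq> X"
    using finite_subset_Union_chain[OF _ _ C] by metis
  then have "Y \<subseteq> X - {x}" using Y by blast
  then have "x \<in> generated F (X - {x})" using generated_mono Y(3) by blast
  then show False using ind[OF X(1)] X(2) unfolding independent_set_def by blast
qed

text \<open>Zorn's lemma gives a maximal independent \<open>M\<close> between \<open>X\<close> and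
  \<open>C\<close>. It generates \<open>C\<close>, since an element of \<open>C\<close> outside
  \<open>generated F M\<close> could be added to \<open>M\<close>.\<close>

lemma extend_to_basis:
  assumes C: "C \<subseteq> A" "closed_under F C" and X: "X \<subseteq> C" "independent_set F X"
  obtains Y where "X \<subseteq> Y" "Y \<subseteq> C" "is_basis F C Y"
proof -
  let ?\<I> = "{Y. X \<subseteq> Y \<and> Y \<subseteq> C \<and> independent_set F Y}"
  have "\<exists>M\<in>?\<I>. \<forall>Z\<in>?\<I>. M \<subseteq> Z \<longrightarrow> Z = M"
  proof (rule subset_Zorn_nonempty)
    show "?\<I> \<noteq> {}" using X by blast
    fix \<C> assume "\<C> \<noteq> {}" and "subset.chain ?\<I> \<C>"
    then have "\<C> \<subseteq> ?\<I>" "subset.chain UNIV \<C>"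
      by (auto simp: subset.chain_def)
    with \<open>\<C> \<noteq> {}\<close> show "\<Union>\<C> \<in> ?\<I>"
      using independent_Union_chain[of \<C>] by blast
  qed
  then obtain M where "M \<in> ?\<I>" and max: "\<forall>Z\<in>?\<I>. M \<subseteq> Z \<longrightarrow> Z = M"
    by (rule bexE)
  then have M: "X \<subseteq> M" "M \<subseteq> C" "independent_set F M" by auto
  have "C \<subseteq> generated F M"
  proof
    fix a assume a: "a \<in> C"
    show "a \<in> generated F M"
    proof (rule ccontr)
      assume a': "a \<notin> generated F M"
      then have "independent_set F (insert a M)"
        using independent_insert[of M a] M a C(1) by auto
      with a M have "insert a M = M"
        by (intro max[rule_format]) auto
      then have "a \<in> M" by (metis insertI1)
      then show False using a' subsetD[OF subset_generated] by metis
    qed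
  qed
  then have "is_basis F C M"
    using generated_least[OF M(2) C(2)] M(3) by (auto simp: is_basis_def)
  with that M show ?thesis by blast
qed

lemma obtain_basis:
  assumes "C \<subseteq> A" "closed_under F C"
  obtains X where "is_basis F C X"
proof -
  have "independent_set F {}" by (simp add: independent_set_def)
  from extend_to_basis[OF assms empty_subsetI this] show ?thesis using that .
qed

lemma is_basis_subset: "is_basis F C X \<Longrightarrow> X \<subseteq> C"
  using subset_generated[of X F] by (simp add: is_basis_def)

text \<open>The common source of all maps built below: \<open>g\<close> is prescribed on a basis of
  \<open>C\<close>, and the basis elements added to reach \<open>A\<close> all go to
  \<open>v\<close>. The image stays in \<open>D\<close> because \<open>D\<close> is closed and
  contains the images of a basis of \<open>A\<close>.\<close>

lemma extend_endomorphism: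
  assumes C: "C \<subseteq> A" "closed_under F C" and X: "is_basis F C X"
    and g: "g \<in> X \<rightarrow> D" and v: "v \<in> D" and D: "D \<subseteq> A" "closed_under F D"
  obtains Y h where "X \<subseteq> Y" "is_basis F A Y" "h \<in> T_semigroup A F D"
    "\<forall>x\<in>X. h x = g x" "\<forall>x\<in>Y - X. h x = v"
proof -
  have "X \<subseteq> A" "independent_set F X"
    using X is_basis_subset[OF X] C(1) unfolding is_basis_def by blast+
  then obtain Y where Y: "X \<subseteq> Y" "Y \<subseteq> A" "is_basis F A Y"
    using extend_to_basis[OF order_refl closed] by metis
  define k where "k x = (if x \<in> X then g x else v)" for x
  have k: "k ` Y \<subseteq> D" using g v by (auto simp: k_def)
  then obtain h where h: "h \<in> endomorphisms A F" "\<forall>x\<in>Y. h x = k x"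
    using free_basis[OF Y(3,2), of k] D(1) by (auto simp: image_subset_iff)
  then have "h ` generated F Y \<subseteq> D"
    using endomorphism_generated_subset[OF h(1) closed D(2) Y(2)] k by simp
  then have "h \<in> T_semigroup A F D"
    using h Y(3) by (simp add: T_semigroup_def is_basis_def)
  with Y show ?thesis
  proof (intro that[of Y h])
    show "\<forall>x\<in>X. h x = g x" "\<forall>x\<in>Y - X. h x = v"
      using h(2) Y(1) by (auto simp: k_def)
  qed
qed

text \<open>Since bases exist, the choice operator in \<open>dimension\<close> does pick
  one.\<close>

lemma is_basis_dimension:
  assumes "C \<subseteq> A" "closed_under F C"
  obtains X where "is_basis F C X" "dimension F C = |X|"
proof
  show "is_basis F C (SOME X. is_basis F C X)"
    using obtain_basis[OF assms] by (metis someI)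
  show "dimension F C = |SOME X. is_basis F C X|" by (simp only: dimension_def)
qed

end

lemma two_le_card_of:
  assumes "ctwo \<le>o |X|"
  obtains x y where "x \<in> X" "y \<in> X" "x \<noteq> y"
proof -
  have "|UNIV :: bool set| \<le>o |X|" using assms unfolding ctwo_def .
  then obtain f :: "bool \<Rightarrow> _" where "inj f" "range f \<subseteq> X"
    using card_of_ordLeq[of "UNIV :: bool set" X] by blast
  then have "f True \<in> X" "f False \<in> X" "f True \<noteq> f False"
    by (auto simp: inj_eq)
  then show ?thesis by (rule that)
qed

lemma card_of_eq_cone:
  assumes "|X| =o cone"
  obtains x where "X = {x}"
proof -
  have "|X| =o |{()}|" using assms unfolding cone_def .
  then obtain f where "bij_betw f X {()}"
    using card_of_ordIso by blast
  then have "card X = 1" using bij_betw_same_card by fastforce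
  then show ?thesis using that card_1_singletonE by metis
qed

section \<open>Green-type relations\<close>

text \<open>The equation \<open>m a f = a\<close> is an instance of cancellation that compares
  \<open>f\<close> with an identity. That identity is an element of \<open>S\<close> if there is
  one, and otherwise the adjoined \<open>None\<close>, whence the case split.\<close>

lemma L_star_subset_L_tilde: "L_star S m \<subseteq> L_tilde S m"
proof (clarify)
  fix a b assume ab: "(a, b) \<in> L_star S m"
  then have S: "a \<in> S" "b \<in> S"
    and eq_iff: "\<And>x y. x \<in> carrier1 S m \<Longrightarrow> y \<in> carrier1 S m \<Longrightarrow>
      mult1 m (Some a) x = mult1 m (Some a) y \<longleftrightarrow> mult1 m (Some b) x = mult1 m (Some b) y"
    by (simp_all add: L_star_def)
  have "m a f = a \<longleftrightarrow> m b f = b" if f: "f \<in> S" for f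
  proof (cases "has_identity S m")
    case True
    then obtain e where "e \<in> S" "\<And>x. x \<in> S \<Longrightarrow> m x e = x"
      unfolding has_identity_def by blast
    then show ?thesis
      using eq_iff[of "Some f" "Some e"] f S by (simp add: carrier1_def)
  next
    case False
    then show ?thesis
      using eq_iff[of "Some f" None] f by (simp add: carrier1_def)
  qed
  with ab show "(a, b) \<in> L_tilde S m"
    by (auto simp: L_star_def L_tilde_def idempotents_def)
qed

lemma R_star_subset_R_tilde: "R_star S m \<subseteq> R_tilde S m"
proof (clarify)
  fix a b assume ab: "(a, b) \<in> R_star S m"
  then have S: "a \<in> S" "b \<in> S"
    and eq_iff: "\<And>x y. x \<in> carrier1 S m \<Longrightarrow> y \<in> carrier1 S m \<Longrightarrow>
      mult1 m x (Some a) = mult1 m y (Some a) \<longleftrightarrow> mult1 m x (Some b) = mult1 m y (Some b)"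
    by (simp_all add: R_star_def)
  have "m f a = a \<longleftrightarrow> m f b = b" if f: "f \<in> S" for f
  proof (cases "has_identity S m")
    case True
    then obtain e where "e \<in> S" "\<And>x. x \<in> S \<Longrightarrow> m e x = x"
      unfolding has_identity_def by blast
    then show ?thesis
      using eq_iff[of "Some f" "Some e"] f S by (simp add: carrier1_def)
  next
    case False
    then show ?thesis
      using eq_iff[of "Some f" None] f by (simp add: carrier1_def)
  qed
  with ab show "(a, b) \<in> R_tilde S m"
    by (auto simp: R_star_def R_tilde_def idempotents_def)
qed

lemma quotient_classes_meet_iff:
  "(\<forall>K\<in>S // r. K \<inter> E \<noteq> {}) \<longleftrightarrow> (\<forall>a\<in>S. \<exists>e\<in>E. (a, e) \<in> r)"
  by (simp add: quotient_def Image_singleton set_eq_iff) blast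

lemma right_abundant_imp_right_Fountain: "right_abundant S m \<Longrightarrow> right_Fountain S m"
  unfolding right_abundant_def right_Fountain_def quotient_classes_meet_iff
  by (meson L_star_subset_L_tilde subsetD)

lemma left_abundant_imp_left_Fountain: "left_abundant S m \<Longrightarrow> left_Fountain S m"
  unfolding left_abundant_def left_Fountain_def quotient_classes_meet_iff
  by (meson R_star_subset_R_tilde subsetD)

text \<open>The idempotent \<open>e\<close> in the class of \<open>a\<close> fixes itself,
  \<open>m e e = e\<close>; testing the relation with \<open>e\<close> itself transfers this to
  \<open>a\<close>.\<close>

lemma left_FountainD:
  assumes "left_Fountain S m" "a \<in> S"
  obtains e where "e \<in> S" "m e a = a"
proof -
  obtain e where e: "(a, e) \<in> R_tilde S m" "e \<in> idempotents S m"
    using assms unfolding left_Fountain_def quotient_classes_meet_iff by blast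
  then show ?thesis using that by (auto simp: R_tilde_def idempotents_def)
qed

section \<open>Endomorphisms with restricted range\<close>

lemma right_comp_apply: "right_comp A a x z = (if z \<in> A then x (a z) else undefined)"
  by (simp add: right_comp_def compose_def)

lemma right_comp_eq_iff:
  "right_comp A a x = right_comp A a y \<longleftrightarrow> (\<forall>z\<in>a ` A. x z = y z)"
proof
  assume "right_comp A a x = right_comp A a y"
  from fun_cong[OF this] show "\<forall>z\<in>a ` A. x z = y z"
    unfolding right_comp_apply by (metis imageE)
next
  assume "\<forall>z\<in>a ` A. x z = y z"
  then show "right_comp A a x = right_comp A a y"
    by (simp add: fun_eq_iff right_comp_apply)
qed

text \<open>Here \<open>id\<close> plays the adjoined identity, so that
  \<open>right_comp A a x = a\<close> becomes an equation between two products. Extensionality makes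
  both sides agree outside \<open>A\<close>.\<close>

lemma right_comp_id: "a \<in> extensional A \<Longrightarrow> right_comp A a id = a"
  by (simp add: fun_eq_iff right_comp_apply extensional_def)

lemma right_comp_eq_left_iff:
  "a \<in> extensional A \<Longrightarrow> right_comp A a x = a \<longleftrightarrow> (\<forall>z\<in>a ` A. x z = z)"
  using right_comp_eq_iff[of A a x id] by (simp add: right_comp_id)

lemma L_star_if_image_eq:
  assumes "a \<in> T_semigroup A F B" "b \<in> T_semigroup A F B" "a ` A = b ` A"
  shows "(a, b) \<in> L_star (T_semigroup A F B) (right_comp A)"
proof -
  have ext: "a \<in> extensional A" "b \<in> extensional A"
    using assms(1,2) endomorphism_extensional by (auto simp: T_semigroup_def)
  have "mult1 (right_comp A) (Some a) x = mult1 (right_comp A) (Some a) y \<longleftrightarrow>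
      mult1 (right_comp A) (Some b) x = mult1 (right_comp A) (Some b) y" for x y
  proof -
    \<comment> \<open>These are the nontrivial cases of \<open>x\<close> and \<open>y\<close>:
      exactly one of them is \<open>None\<close>, in either order, or neither is. Each equation
      depends only on the common image.\<close>
    have *: "right_comp A a f = a \<longleftrightarrow> right_comp A b f = b"
      "a = right_comp A a f \<longleftrightarrow> b = right_comp A b f"
      "right_comp A a f = right_comp A a g \<longleftrightarrow> right_comp A b f = right_comp A b g" for f g
      using ext by (auto simp only: right_comp_eq_left_iff right_comp_eq_iff assms(3)
          eq_commute[of a] eq_commute[of b])
    show ?thesis by (cases x; cases y) (simp_all add: *)
  qed
  with assms(1,2) show ?thesis by (simp add: L_star_def)
qed

context independence_algebra
begin

lemma idempotent_with_image:
  assumes B: "B \<subseteq> A" and C: "C \<subseteq> B" "closed_under F C" "C \<noteq> {}"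
  obtains e where "e \<in> idempotents (T_semigroup A F B) (right_comp A)" "e ` A = C"
proof -
  have CA: "C \<subseteq> A" using B C by blast
  obtain X where X: "is_basis F C X" using obtain_basis[OF CA C(2)] .
  \<comment> \<open>The value for basis elements of \<open>A\<close> outside \<open>X\<close>. It is
    taken from \<open>C\<close> because \<open>X\<close> is empty when \<open>C\<close> consists of
    constants.\<close>
  obtain c where c: "c \<in> C" using C by blast
  have "id \<in> X \<rightarrow> C" using is_basis_subset[OF X] by auto
  from extend_endomorphism[OF CA C(2) X this c CA C(2)] obtain Y e where
    "X \<subseteq> Y" "is_basis F A Y" and e: "e \<in> T_semigroup A F C"
      "\<forall>x\<in>X. e x = id x" "\<forall>x\<in>Y - X. e x = c" .
  then have endo: "e \<in> endomorphisms A F" and im: "e ` A \<subseteq> C" by (auto simp: T_semigroup_def)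
  have "X \<subseteq> A" using is_basis_subset[OF X] CA by blast
  then have fixed: "e z = z" if "z \<in> C" for z
  proof (rule endomorphism_fixes_generated[OF endo closed])
    show "z \<in> generated F X" using that X by (simp add: is_basis_def)
    show "e x = x" if "x \<in> X" for x using e(2) that by simp
  qed
  then have "C \<subseteq> e ` A" using CA by (metis image_eqI subsetD subsetI)
  with im have "e ` A = C" by (rule equalityI)
  \<comment> \<open>A map fixing its image pointwise is idempotent.\<close>
  moreover have "\<forall>z\<in>e ` A. e z = z" using fixed im by auto
  then have "right_comp A e e = e"
    by (simp only: right_comp_eq_left_iff[OF endomorphism_extensional[OF endo]])
  moreover have "e \<in> T_semigroup A F B" using e(1) C(1) by (auto simp: T_semigroup_def)
  ultimately show ?thesis using that by (simp add: idempotents_def)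
qed

lemma right_abundant_T_semigroup:
  assumes "B \<subseteq> A"
  shows "right_abundant (T_semigroup A F B) (right_comp A)"
  unfolding right_abundant_def quotient_classes_meet_iff
proof
  fix a assume a: "a \<in> T_semigroup A F B"
  then have endo: "a \<in> endomorphisms A F" and im: "a ` A \<subseteq> B" by (auto simp: T_semigroup_def)
  \<comment> \<open>The image of \<open>a\<close> is itself a subalgebra inside \<open>B\<close>, so
    it can serve as \<open>C\<close>.\<close>
  from idempotent_with_image[OF assms im endomorphism_image_closed[OF endo order_refl closed]]
  obtain e where e: "e \<in> idempotents (T_semigroup A F B) (right_comp A)" "e ` A = a ` A"
    using nonempty by blast
  with a have "(a, e) \<in> L_star (T_semigroup A F B) (right_comp A)"
    by (intro L_star_if_image_eq) (auto simp: idempotents_def)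
  with e show "\<exists>e\<in>idempotents (T_semigroup A F B) (right_comp A).
      (a, e) \<in> L_star (T_semigroup A F B) (right_comp A)" by blast
qed

lemma not_left_Fountain_T_semigroup:
  assumes B: "B \<subseteq> A" "closed_under F B" "B \<noteq> A"
    and uv: "u \<in> B" "v \<in> B" "v \<notin> generated F {u}"
  shows "\<not> left_Fountain (T_semigroup A F B) (right_comp A)"
proof
  assume lF: "left_Fountain (T_semigroup A F B) (right_comp A)"
  obtain X where X: "is_basis F B X" using obtain_basis[OF B(1,2)] .
  \<comment> \<open>The map \<open>a\<close> is to collapse \<open>B\<close> into
    \<open>generated F {u}\<close> while still reaching \<open>v\<close> from outside
    \<open>B\<close>.\<close>
  have "(\<lambda>_. u) \<in> X \<rightarrow> B" using uv by simp
  from extend_endomorphism[OF B(1,2) X this uv(2) B(1,2)] obtain Y a where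
    Y: "X \<subseteq> Y" "is_basis F A Y" and a: "a \<in> T_semigroup A F B"
      "\<forall>x\<in>X. a x = u" "\<forall>x\<in>Y - X. a x = v" .
  \<comment> \<open>One set cannot generate both \<open>B\<close> and \<open>A\<close>, so some
    basis element \<open>z\<close> is left over and has \<open>a z = v\<close>.\<close>
  have "X \<noteq> Y" using X Y B(3) by (auto simp: is_basis_def)
  then obtain z where z: "z \<in> Y - X" using Y(1) by blast
  then have zA: "z \<in> A" using is_basis_subset[OF Y(2)] by blast
  have endo: "a \<in> endomorphisms A F" using a(1) by (simp add: T_semigroup_def)
  have "a ` X \<subseteq> generated F {u}"
    using a(2) subset_generated[of "{u}" F] by auto
  then have "a ` generated F X \<subseteq> generated F {u}"
    using endomorphism_generated_subset[OF endo closed closed_under_generated]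
      is_basis_subset[OF X] B(1) by simp
  then have aB: "a ` B \<subseteq> generated F {u}" using X by (simp add: is_basis_def)
  obtain e where e: "e \<in> T_semigroup A F B" "right_comp A e a = a"
    using left_FountainD[OF lF a(1)] .
  have "a z = a (e z)"
    using fun_cong[OF e(2), of z] zA by (simp add: right_comp_def compose_def)
  \<comment> \<open>\<open>e\<close> has its range in \<open>B\<close>, so \<open>a (e z)\<close>
    lies in the collapsed part, contradicting \<open>a z = v\<close>.\<close>
  also have "\<dots> \<in> generated F {u}"
    using e(1) zA aB by (auto simp: T_semigroup_def)
  finally show False using a(3) z uv(3) by metis
qed

end

theorem mainTheorem14:
  fixes A B :: "'a set" and F :: "'a operation set"
  assumes "independence_algebra A F"
    and "is_subalgebra A F B" and "B \<noteq> {}" and "B \<noteq> A"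
    and "ctwo \<le>o dimension F B \<or> (generated F {} \<noteq> {} \<and> dimension F B =o cone)"
  shows "right_abundant (T_semigroup A F B) (right_comp A)
    \<and> right_Fountain (T_semigroup A F B) (right_comp A)
    \<and> \<not> left_abundant (T_semigroup A F B) (right_comp A)
    \<and> \<not> left_Fountain (T_semigroup A F B) (right_comp A)"
proof -
  interpret independence_algebra A F by fact
  have B: "B \<subseteq> A" "closed_under F B" using assms(2) by (auto simp: is_subalgebra_def)
  obtain X where X: "is_basis F B X" "dimension F B = |X|"
    using is_basis_dimension[OF B] .
  have XB: "X \<subseteq> B" and ind: "\<And>x. x \<in> X \<Longrightarrow> x \<notin> generated F (X - {x})"
    using X(1) is_basis_subset by (auto simp: is_basis_def independent_set_def)
  have "\<exists>u\<in>B. \<exists>v\<in>B. v \<notin> generated F {u}"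
    using assms(5)
  proof
    \<comment> \<open>Two distinct basis elements serve as \<open>u\<close> and \<open>v\<close>, by
      independence.\<close>
    assume "ctwo \<le>o dimension F B"
    then obtain u v where uv: "u \<in> X" "v \<in> X" "u \<noteq> v"
      using two_le_card_of X(2) by metis
    then have "{u} \<subseteq> X - {v}" by blast
    then have "v \<notin> generated F {u}" using generated_mono ind[OF uv(2)] by blast
    then show ?thesis using uv XB by blast
  next
    \<comment> \<open>A constant \<open>c\<close> serves as \<open>u\<close>: it generates only
      constants, and the sole basis element \<open>v\<close> is not one of them.\<close>
    assume *: "generated F {} \<noteq> {} \<and> dimension F B =o cone"
    then obtain v where v: "X = {v}" using card_of_eq_cone X(2) by metis
    from * obtain c where c: "c \<in> generated F {}" by blast
    have "generated F {c} \<subseteq> generated F {}"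
      using c closed_under_generated by (intro generated_least) auto
    moreover have "v \<notin> generated F {}" using ind[of v] v by simp
    moreover have "c \<in> B" using c generated_least[OF _ B(2), of "{}"] by blast
    ultimately show ?thesis using v XB by blast
  qed
  then have "\<not> left_Fountain (T_semigroup A F B) (right_comp A)"
    using not_left_Fountain_T_semigroup[OF B assms(4)] by blast
  then show ?thesis
    using right_abundant_T_semigroup[OF B(1)] right_abundant_imp_right_Fountain
      left_abundant_imp_left_Fountain by blast
qed

end
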